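(* Let $A=(a_{ij})\in\mathbb{R}^{n\times n}$ be such that $-A$ is an $\mathcal{H}_+$ matrix and the comparison matrix $\mathcal{M}(A)$ is nonsingular. Then the following hold. 1) There exist entrywise positive vectors $v=(v_1,\dots,v_n)^T$ and $w=(w_1,\dots,w_n)^T$ in $\mathbb{R}^n$ such that $\mathcal{M}(A)v$ and $w^T\mathcal{M}(A)$ are also entrywise positive. 2) There exists a diagonal matrix $X\in\mathbb{R}^{n\times n}$ such that $-(AX+XA^T)$ is an $\mathcal{H}_+$ matrix. Moreover, for any $v,w$ as in 1), one can choose $X=P_vP_w^{-1}$, where $P_v=\mathrm{diag}\{v_1,\dots,v_n\}$ and $P_w=\mathrm{diag}\{w_1,\dots,w_n\}$. 3) For any $v,w$ as in 1), with $P_w=\mathrm{diag}\{w_1,\dots,w_n\}$, there exists a diagonal positive definite matrix $Y\in\mathbb{R}^{n\times n}$ such that $$-P_wAP_w^{-1}Y-YP_w^{-1}A^TP_w\in\mathcal{DD}_+.$$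
   Context: For $A=(a_{ij})\in\mathbb{R}^{n\times n}$, the comparison matrix $\mathcal{M}(A)\in\mathbb{R}^{n\times n}$ is defined by $\mathcal{M}_{ii}(A)=|a_{ii}|$ and $\mathcal{M}_{ij}(A)=-|a_{ij}|$ for $i\neq j$. A matrix $A\in\mathbb{R}^{n\times n}$ is an $\mathcal{H}$ matrix if the minimal real part of the eigenvalues of $\mathcal{M}(A)$ is greater than or equal to zero. An $\mathcal{H}_+$ matrix is an $\mathcal{H}$ matrix all of whose diagonal entries are positive. A matrix $B=(b_{ij})\in\mathbb{R}^{n\times n}$ is strictly row diagonally dominant if $|b_{ii}|>\sum_{j\neq i}|b_{ij}|$ for all $i$. $\mathcal{DD}_+$ denotes the set of matrices $B\in\mathbb{R}^{n\times n}$ such that both $B$ and $B^T$ are strictly row diagonally dominant and $b_{ii}>0$ for all $i$. *)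

theory Defs
  imports
    "Jordan_Normal_Form.Gauss_Jordan_Elimination"
    "Jordan_Normal_Form.Spectral_Radius"
begin

definition comparison_mat :: "real mat \<Rightarrow> real mat" where
  "comparison_mat A = mat (dim_row A) (dim_col A)
     (\<lambda>(i, j). if i = j then \<bar>A $$ (i, i)\<bar> else - \<bar>A $$ (i, j)\<bar>)"

(* Eigenvalues of a real matrix are taken in the complex numbers. For n > 0 the spectrum is
   finite and nonempty, so that Min is the minimum; for n = 0 the value is unspecified. *)
definition min_Re_eigenvalue :: "real mat \<Rightarrow> real" where
  "min_Re_eigenvalue A = Min (Re ` spectrum (map_mat complex_of_real A))"

definition H_mats :: "nat \<Rightarrow> real mat set" where
  "H_mats n = {A \<in> carrier_mat n n. min_Re_eigenvalue (comparison_mat A) \<ge> 0}"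

definition H_plus_mats :: "nat \<Rightarrow> real mat set" where
  "H_plus_mats n = {A \<in> H_mats n. \<forall>i < n. A $$ (i, i) > 0}"

definition strictly_row_diag_dominant :: "real mat \<Rightarrow> bool" where
  "strictly_row_diag_dominant B \<longleftrightarrow>
     (\<forall>i < dim_row B. \<bar>B $$ (i, i)\<bar> > (\<Sum>j \<in> {..<dim_col B} - {i}. \<bar>B $$ (i, j)\<bar>))"

definition DD_plus :: "nat \<Rightarrow> real mat set" where
  "DD_plus n = {B \<in> carrier_mat n n.
     strictly_row_diag_dominant B \<and> strictly_row_diag_dominant (transpose_mat B) \<and>
     (\<forall>i < n. B $$ (i, i) > 0)}"

definition positive_vec :: "real vec \<Rightarrow> bool" where
  "positive_vec v \<longleftrightarrow> (\<forall>i < dim_vec v. v $ i > 0)"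

definition vec_mult_mat :: "real vec \<Rightarrow> real mat \<Rightarrow> real vec" where
  "vec_mult_mat w M = row (mat_of_row w * M) 0"

definition diag_of_vec :: "real vec \<Rightarrow> real mat" where
  "diag_of_vec v = mat_diag (dim_vec v) (\<lambda>i. v $ i)"

(* The library's mat_inverse is option-valued; this is only meaningful for invertible A. *)
definition inv_mat :: "real mat \<Rightarrow> real mat" where
  "inv_mat A = the (mat_inverse A)"

definition positive_definite :: "real mat \<Rightarrow> bool" where
  "positive_definite Y \<longleftrightarrow> square_mat Y \<and> transpose_mat Y = Y \<and>
     (\<forall>x \<in> carrier_vec (dim_row Y). x \<noteq> 0\<^sub>v (dim_row Y) \<longrightarrow> x \<bullet> (Y *\<^sub>v x) > 0)"

definition positive_pair :: "nat \<Rightarrow> real mat \<Rightarrow> real vec \<Rightarrow> real vec \<Rightarrow> bool" where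
  "positive_pair n M v w \<longleftrightarrow>
     v \<in> carrier_vec n \<and> w \<in> carrier_vec n \<and> positive_vec v \<and> positive_vec w \<and>
     positive_vec (M *\<^sub>v v) \<and> positive_vec (vec_mult_mat w M)"

end

theory Submission
  imports Defs
begin

text \<open>
  Write \<open>M\<close> for the comparison matrix of \<open>A\<close>. The hypotheses say that no \<open>M + t I\<close> with
  \<open>t \<ge> 0\<close> is singular (\<open>det_shift_nonzero\<close>): otherwise \<open>- t\<close> would be an eigenvalue of \<open>M\<close>, which
  has none that is negative, and \<open>0\<close> is excluded by nonsingularity.

  Existence of \<open>v\<close> and \<open>w\<close> (\<open>z_matrix_semipositive\<close>) is a descent along the line \<open>M + t I\<close>. Let
  \<open>t\<^sub>0\<close> be the infimum of those \<open>t \<ge> 0\<close> for which some positive \<open>y\<close> has \<open>(M + t I) y\<close> positive,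
  and solve \<open>(M + t\<^sub>0 I) x = (1,\<dots>,1)\<close>. For an admissible \<open>t \<ge> t\<^sub>0\<close> close to \<open>t\<^sub>0\<close> the vector
  \<open>(M + t I) x\<close> is still positive, and admissibility makes \<open>M + t I\<close> inverse-nonnegative
  (\<open>z_matrix_monotone\<close>), so \<open>x\<close> is nonnegative and then positive. This single \<open>x\<close> also works
  slightly below \<open>t\<^sub>0\<close>, which forces \<open>t\<^sub>0 = 0\<close>. The argument is invariant under transposition, which
  gives \<open>w\<close>.

  The other two assertions are one inequality read in two ways. Positivity of \<open>M v\<close> and
  \<open>w\<^sup>T M\<close> gives, for every row \<open>i\<close>,
  \<open>(\<Sum>j\<noteq>i. \<bar>w\<^sub>i a\<^sub>i\<^sub>j v\<^sub>j + v\<^sub>i a\<^sub>j\<^sub>i w\<^sub>j\<bar>) < 2 \<bar>a\<^sub>i\<^sub>i\<bar> v\<^sub>i w\<^sub>i\<close>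
  (\<open>positive_pair_row_dominance\<close>). For \<open>Y = P\<^sub>v P\<^sub>w\<close> the matrix of the third assertion is
  symmetric with exactly these rows up to sign, hence lies in \<open>DD\<^sub>+\<close>. For \<open>X = P\<^sub>v P\<^sub>w\<^sup>-\<^sup>1\<close>
  the matrix \<open>C\<close> of the second assertion has \<open>P\<^sub>w C P\<^sub>w\<close> equal to that same matrix, so \<open>C\<close> is
  diagonally dominant with weights \<open>w\<close>, and a weighted Gershgorin argument
  (\<open>weighted_dominance_imp_Re_pos\<close>) puts the spectrum of its comparison matrix into the open
  right half plane.
\<close>

section \<open>Entries of matrix products\<close>

lemma mult_mat_vec_index_sum:
  assumes "M \<in> carrier_mat m n" "x \<in> carrier_vec n" "i < m"
  shows "(M *\<^sub>v x) $ i = (\<Sum>j<n. M $$ (i, j) * x $ j)"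
  using assms by (auto simp: scalar_prod_def lessThan_atLeast0 intro!: sum.cong)

lemma vec_mult_mat_index_sum:
  assumes "M \<in> carrier_mat n m" "w \<in> carrier_vec n" "i < m"
  shows "vec_mult_mat w M $ i = (\<Sum>j<n. w $ j * M $$ (j, i))"
  using assms by (auto simp: vec_mult_mat_def mat_of_row_def scalar_prod_def lessThan_atLeast0
      intro!: sum.cong)

lemma vec_mult_mat_carrier [simp]:
  assumes "M \<in> carrier_mat n m"
  shows "vec_mult_mat w M \<in> carrier_vec m"
  using assms by (auto simp: vec_mult_mat_def intro!: carrier_vecI)

lemma vec_mult_mat_eq_transpose:
  assumes "M \<in> carrier_mat n m" "w \<in> carrier_vec n"
  shows "vec_mult_mat w M = transpose_mat M *\<^sub>v w"
proof (rule eq_vecI)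
  fix i assume "i < dim_vec (transpose_mat M *\<^sub>v w)"
  then have i: "i < m" using assms by auto
  show "vec_mult_mat w M $ i = (transpose_mat M *\<^sub>v w) $ i"
    using assms i mult_mat_vec_index_sum[of "transpose_mat M" m n w i]
    by (auto simp: vec_mult_mat_index_sum[OF assms i] mult.commute intro!: sum.cong)
qed (use assms vec_mult_mat_carrier[OF assms(1), of w] in auto)

lemma shift_mult_mat_vec_index:
  fixes M :: "'a :: comm_semiring_1 mat"
  assumes "M \<in> carrier_mat n n" "x \<in> carrier_vec n" "i < n"
  shows "((M + t \<cdot>\<^sub>m 1\<^sub>m n) *\<^sub>v x) $ i = (\<Sum>j<n. M $$ (i, j) * x $ j) + t * x $ i"
proof -
  have "M + t \<cdot>\<^sub>m 1\<^sub>m n \<in> carrier_mat n n" using assms by simp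
  then have "((M + t \<cdot>\<^sub>m 1\<^sub>m n) *\<^sub>v x) $ i
      = (\<Sum>j<n. (M + t \<cdot>\<^sub>m 1\<^sub>m n) $$ (i, j) * x $ j)"
    using assms(2,3) by (rule mult_mat_vec_index_sum)
  also have "\<dots> = (\<Sum>j<n. M $$ (i, j) * x $ j + (if j = i then t * x $ i else 0))"
    using assms by (intro sum.cong) (auto simp: distrib_right)
  finally show ?thesis using assms by (simp add: sum.distrib)
qed

lemma inv_mat_eqI:
  assumes "B \<in> carrier_mat n n" "C \<in> carrier_mat n n" "B * C = 1\<^sub>m n" "C * B = 1\<^sub>m n"
  shows "inv_mat B = C"
proof (cases "mat_inverse B")
  case None
  then show ?thesis
    using mat_inverse(1)[OF assms(1) None, of undefined] assms
    by (auto simp: Units_def ring_mat_def)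
next
  case (Some D)
  then have D: "D * B = 1\<^sub>m n" "D \<in> carrier_mat n n"
    using mat_inverse(2)[OF assms(1)] by auto
  have "D = D * (B * C)" using assms D by simp
  also have "\<dots> = (D * B) * C" using assoc_mult_mat[OF D(2) assms(1,2)] by simp
  also have "\<dots> = C" using assms D by simp
  finally show ?thesis using D assms Some by (simp add: inv_mat_def)
qed

lemma inv_mat_diag_of_vec:
  assumes "w \<in> carrier_vec n" "\<And>i. i < n \<Longrightarrow> w $ i \<noteq> 0"
  shows "inv_mat (diag_of_vec w) = mat_diag n (\<lambda>i. 1 / w $ i)"
proof (rule inv_mat_eqI[where n = n])
  have "mat_diag n (\<lambda>i. w $ i * (1 / w $ i)) = (1\<^sub>m n :: real mat)"
    and "mat_diag n (\<lambda>i. (1 / w $ i) * w $ i) = (1\<^sub>m n :: real mat)"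
    using assms by (auto intro!: eq_matI simp: mat_diag_def)
  with assms show "diag_of_vec w * mat_diag n (\<lambda>i. 1 / w $ i) = 1\<^sub>m n"
    and "mat_diag n (\<lambda>i. 1 / w $ i) * diag_of_vec w = 1\<^sub>m n"
    by (auto simp: diag_of_vec_def)
qed (use assms in \<open>auto simp: diag_of_vec_def\<close>)

lemma diagonal_mat_mat_diag [simp]: "diagonal_mat (mat_diag n f)"
  by (auto simp: diagonal_mat_def mat_diag_def)

lemma positive_definite_mat_diag:
  assumes "\<And>i. i < n \<Longrightarrow> f i > 0"
  shows "positive_definite (mat_diag n f)"
proof -
  have "x \<bullet> (mat_diag n f *\<^sub>v x) > 0" if x: "x \<in> carrier_vec n" "x \<noteq> 0\<^sub>v n" for x
  proof -
    obtain k where k: "k < n" "x $ k \<noteq> 0" using x by (metis carrier_vecD eq_vecI index_zero_vec)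
    have D: "(mat_diag n f *\<^sub>v x) $ i = f i * x $ i" if "i < n" for i
    proof -
      have "(mat_diag n f *\<^sub>v x) $ i = (\<Sum>j<n. if j = i then f i * x $ i else 0)"
        unfolding mult_mat_vec_index_sum[OF mat_diag_dim x(1) that]
        using that by (intro sum.cong) (auto simp: mat_diag_def)
      then show ?thesis using that by simp
    qed
    have "x \<bullet> (mat_diag n f *\<^sub>v x) = (\<Sum>i<n. f i * (x $ i)\<^sup>2)"
      using D by (auto simp: scalar_prod_def lessThan_atLeast0 power2_eq_square mat_diag_def
          intro!: sum.cong)
    also have "\<dots> > 0"
      using k assms by (intro sum_pos2[of _ k]) (auto simp: less_imp_le)
    finally show ?thesis .
  qed
  then show ?thesis
    by (auto simp: positive_definite_def mat_diag_def intro!: eq_matI)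
qed

section \<open>Z-matrices and positive vectors\<close>

text \<open>
  The idea is to subtract from \<open>x\<close> the multiple of \<open>v\<close> that touches it from below. The difference
  is nonnegative with a zero entry \<open>k\<close>, and a Z-matrix cannot map such a vector to one with a
  positive entry \<open>k\<close>. If \<open>x\<close> had a negative entry, the multiple would be negative and the whole
  image of the difference positive.
\<close>

lemma z_matrix_monotone:
  fixes m :: "nat \<Rightarrow> nat \<Rightarrow> real"
  assumes z: "\<And>i j. i < n \<Longrightarrow> j < n \<Longrightarrow> i \<noteq> j \<Longrightarrow> m i j \<le> 0"
    and v: "\<And>i. i < n \<Longrightarrow> v i > 0"
    and mv: "\<And>i. i < n \<Longrightarrow> (\<Sum>j<n. m i j * v j) > 0"
    and mx: "\<And>i. i < n \<Longrightarrow> (\<Sum>j<n. m i j * x j) \<ge> 0"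
    and i: "i < n"
  shows "x i \<ge> 0"
proof (rule ccontr)
  assume neg: "\<not> x i \<ge> 0"
  define c where "c = Min ((\<lambda>j. x j / v j) ` {..<n})"
  have "c \<in> (\<lambda>j. x j / v j) ` {..<n}"
    unfolding c_def using i by (intro Min_in) auto
  then obtain k where k: "k < n" "c = x k / v k" by auto
  have cle: "c \<le> x j / v j" if "j < n" for j
    unfolding c_def using that by (intro Min_le) auto
  have "x i / v i < 0" using neg v[OF i] by (simp add: divide_neg_pos)
  with cle[OF i] have c: "c < 0" by linarith
  have "(\<Sum>j<n. m k j * (x j - c * v j)) \<le> 0"
  proof (rule sum_nonpos)
    fix j assume "j \<in> {..<n}"
    then have j: "j < n" by simp
    have "x j - c * v j \<ge> 0" using cle[OF j] v[OF j] by (simp add: field_simps)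
    moreover have "x k - c * v k = 0" using k v[OF k(1)] by simp
    ultimately show "m k j * (x j - c * v j) \<le> 0"
      using z[OF k(1) j] by (cases "j = k") (auto intro: mult_nonpos_nonneg)
  qed
  moreover have "(\<Sum>j<n. m k j * (x j - c * v j))
      = (\<Sum>j<n. m k j * x j) - c * (\<Sum>j<n. m k j * v j)"
    by (simp add: sum_subtractf sum_distrib_left algebra_simps)
  ultimately show False
    using mx[OF k(1)] mult_neg_pos[OF c mv[OF k(1)]] by linarith
qed

text \<open>
  Such a vector \<open>x\<close> witnesses that a Z-matrix is a nonsingular M-matrix. The hypothesis on the
  determinants is the form of "no eigenvalue in \<open>(-\<infinity>, 0]\<close>" that transposition visibly preserves.
\<close>

lemma z_matrix_semipositive:
  fixes M :: "real mat"
  assumes M: "M \<in> carrier_mat n n"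
    and z: "\<And>i j. i < n \<Longrightarrow> j < n \<Longrightarrow> i \<noteq> j \<Longrightarrow> M $$ (i, j) \<le> 0"
    and d: "\<And>t. t \<ge> 0 \<Longrightarrow> det (M + t \<cdot>\<^sub>m 1\<^sub>m n) \<noteq> 0"
  obtains x where "x \<in> carrier_vec n" "\<And>i. i < n \<Longrightarrow> x $ i > 0"
    "\<And>i. i < n \<Longrightarrow> (M *\<^sub>v x) $ i > 0"
proof -
  define r where "r i x = (\<Sum>j<n. M $$ (i, j) * x j)" for i :: nat and x :: "nat \<Rightarrow> real"
  define S where "S = {t. t \<ge> 0 \<and> (\<exists>x. (\<forall>i<n. x i > 0) \<and> (\<forall>i<n. r i x + t * x i > 0))}"
  have S_ne: "S \<noteq> {}"
  proof -
    \<comment> \<open>A shift exceeding all row sums of \<open>M\<close> in absolute value is admissible with \<open>(1,\<dots>,1)\<close>.\<close>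
    define t where "t = 1 + (\<Sum>i<n. \<bar>r i (\<lambda>_. 1)\<bar>)"
    have "r i (\<lambda>_. 1) + t > 0" if "i < n" for i
    proof -
      have "\<bar>r i (\<lambda>_. 1)\<bar> \<le> (\<Sum>i<n. \<bar>r i (\<lambda>_. 1)\<bar>)"
        using that by (intro member_le_sum) auto
      then show ?thesis unfolding t_def by linarith
    qed
    moreover have "t \<ge> 0" unfolding t_def by (simp add: sum_nonneg add_nonneg_nonneg)
    ultimately have "t \<in> S" unfolding S_def by (auto intro!: exI[of _ "\<lambda>_. 1"])
    then show ?thesis by auto
  qed
  have S_bdd: "bdd_below S" unfolding S_def by (auto intro: bdd_belowI[of _ 0])
  define t0 where "t0 = Inf S"
  have t0: "t0 \<ge> 0" unfolding t0_def by (rule cInf_greatest[OF S_ne]) (auto simp: S_def)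
  define N where "N = M + t0 \<cdot>\<^sub>m 1\<^sub>m n"
  have N: "N \<in> carrier_mat n n" using M by (simp add: N_def)
  have "det N \<noteq> 0" using d t0 unfolding N_def by auto
  then obtain B where B: "B \<in> carrier_mat n n" "N * B = 1\<^sub>m n"
    using det_non_zero_imp_unit[OF N, of undefined] by (auto simp: Units_def ring_mat_def)
  define xv where "xv = B *\<^sub>v vec n (\<lambda>_. 1)"
  have xv: "xv \<in> carrier_vec n" using B by (simp add: xv_def)
  have Nx: "N *\<^sub>v xv = vec n (\<lambda>_. 1)"
    unfolding xv_def using N B by (simp flip: assoc_mult_mat_vec[of _ n n _ n])
  define x where "x i = xv $ i" for i
  have row: "r i x + t0 * x i = 1" if i: "i < n" for i
  proof -
    have "(N *\<^sub>v xv) $ i = r i x + t0 * x i"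
      unfolding N_def r_def x_def using M xv i by (rule shift_mult_mat_vec_index)
    then show ?thesis using Nx i by simp
  qed
  \<comment> \<open>Moving \<open>t\<close> by at most \<open>e\<close> from \<open>t0\<close> changes each entry of the image of \<open>x\<close> by less than 1.\<close>
  define e where "e = 1 / (1 + (\<Sum>i<n. \<bar>x i\<bar>))"
  have den: "1 + (\<Sum>i<n. \<bar>x i\<bar>) > 0" by (simp add: sum_nonneg add_pos_nonneg)
  then have e: "e > 0" by (simp add: e_def)
  have near: "r i x + t * x i > 0" if i: "i < n" and t: "\<bar>t - t0\<bar> \<le> e" for i t
  proof -
    have "\<bar>x i\<bar> \<le> (\<Sum>i<n. \<bar>x i\<bar>)" using i by (intro member_le_sum) auto
    then have "e * \<bar>x i\<bar> < 1" using den by (simp add: e_def)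
    moreover have "\<bar>(t - t0) * x i\<bar> \<le> e * \<bar>x i\<bar>"
      using t by (simp add: abs_mult mult_right_mono)
    ultimately have "\<bar>(t - t0) * x i\<bar> < 1" by linarith
    moreover have "r i x + t * x i = 1 + (t - t0) * x i"
      using row[OF i] by (simp add: algebra_simps)
    ultimately show ?thesis by linarith
  qed
  have "Inf S < t0 + e" using e unfolding t0_def by simp
  then obtain t where t: "t \<in> S" "t < t0 + e" using cInf_lessD[OF S_ne] by auto
  have "t0 \<le> t" unfolding t0_def using t S_bdd by (intro cInf_lower)
  with t have tn: "\<bar>t - t0\<bar> \<le> e" by auto
  obtain y where y: "\<And>i. i < n \<Longrightarrow> y i > 0" "\<And>i. i < n \<Longrightarrow> r i y + t * y i > 0"
    using t(1) by (auto simp: S_def)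
  have shift: "(\<Sum>j<n. (M $$ (i, j) + (if j = i then t else 0)) * u j) = r i u + t * u i"
    if "i < n" for i u
  proof -
    have "(\<Sum>j<n. (M $$ (i, j) + (if j = i then t else 0)) * u j)
        = (\<Sum>j<n. M $$ (i, j) * u j + (if j = i then t * u i else 0))"
      by (intro sum.cong) (auto simp: algebra_simps)
    then show ?thesis using that by (simp add: r_def sum.distrib)
  qed
  have nonneg: "x i \<ge> 0" if i: "i < n" for i
    by (rule z_matrix_monotone[where n = n and v = y
          and m = "\<lambda>i j. M $$ (i, j) + (if j = i then t else 0)"])
      (use i y z near[OF _ tn] in \<open>auto simp: shift less_imp_le\<close>)
  have pos: "x i > 0" if i: "i < n" for i
  proof (rule ccontr)
    assume "\<not> x i > 0"
    then have xi: "x i = 0" using nonneg[OF i] by simp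
    have "r i x \<le> 0" unfolding r_def
    proof (rule sum_nonpos)
      fix j assume "j \<in> {..<n}"
      then show "M $$ (i, j) * x j \<le> 0"
        using xi z[OF i, of j] nonneg[of j] by (cases "j = i") (auto intro: mult_nonpos_nonneg)
    qed
    then show False using row[OF i] xi by simp
  qed
  have "t0 = 0"
  proof (rule ccontr)
    assume "t0 \<noteq> 0"
    define s where "s = max 0 (t0 - e)"
    have s: "s \<ge> 0" "s < t0" "\<bar>s - t0\<bar> \<le> e"
      using t0 \<open>t0 \<noteq> 0\<close> e by (auto simp: s_def max_def)
    then have "s \<in> S" unfolding S_def using pos near by blast
    then have "t0 \<le> s" unfolding t0_def using S_bdd by (intro cInf_lower)
    then show False using s by simp
  qed
  then have "(M *\<^sub>v xv) $ i > 0" if i: "i < n" for i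
    using row[OF i] mult_mat_vec_index_sum[OF M xv i] by (simp add: r_def x_def)
  then show thesis using that[OF xv] pos by (auto simp: x_def)
qed

section \<open>Eigenvalues\<close>

text \<open>
  Gershgorin's argument for \<open>U\<^sup>-\<^sup>1 B U\<close> with \<open>U = diag u\<close>: look at the entry of an eigenvector that
  is largest relative to \<open>u\<close>. The eigenvalue then has distance less than \<open>B $$ (k, k)\<close> from
  that positive diagonal entry.
\<close>

lemma weighted_dominance_imp_Re_pos:
  fixes B :: "real mat"
  assumes B: "B \<in> carrier_mat n n"
    and u: "\<And>i. i < n \<Longrightarrow> u i > 0"
    and dom: "\<And>i. i < n \<Longrightarrow> (\<Sum>j\<in>{..<n} - {i}. \<bar>B $$ (i, j)\<bar> * u j) < B $$ (i, i) * u i"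
    and l: "l \<in> spectrum (map_mat complex_of_real B)"
  shows "Re l > 0"
proof -
  let ?B = "map_mat complex_of_real B"
  obtain x where x: "x \<in> carrier_vec n" "x \<noteq> 0\<^sub>v n" "?B *\<^sub>v x = l \<cdot>\<^sub>v x"
    using l B by (auto simp: spectrum_def eigenvalue_def eigenvector_def)
  obtain p where p: "p < n" "x $ p \<noteq> 0" using x by (metis carrier_vecD eq_vecI index_zero_vec)
  define c where "c = Max ((\<lambda>j. cmod (x $ j) / u j) ` {..<n})"
  have "c \<in> (\<lambda>j. cmod (x $ j) / u j) ` {..<n}"
    unfolding c_def using p by (intro Max_in) auto
  then obtain k where k: "k < n" "c = cmod (x $ k) / u k" by auto
  have c_ge: "cmod (x $ j) / u j \<le> c" if "j < n" for j
    unfolding c_def using that by (intro Max_ge) auto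
  have le: "cmod (x $ j) \<le> c * u j" if "j < n" for j
    using c_ge[OF that] u[OF that] by (simp add: field_simps)
  have "0 < cmod (x $ p) / u p" using p u by simp
  with c_ge[OF p(1)] have c: "c > 0" by linarith
  have xk: "cmod (x $ k) = c * u k" using k u[OF k(1)] by simp
  have "(\<Sum>j<n. complex_of_real (B $$ (k, j)) * x $ j) = l * x $ k"
    using mult_mat_vec_index_sum[of ?B n n x k] x B k by simp
  then have "(l - complex_of_real (B $$ (k, k))) * x $ k
      = (\<Sum>j\<in>{..<n} - {k}. complex_of_real (B $$ (k, j)) * x $ j)"
    using k by (simp add: sum.remove[of "{..<n}" k] algebra_simps)
  then have "cmod (l - complex_of_real (B $$ (k, k))) * cmod (x $ k)
      = cmod (\<Sum>j\<in>{..<n} - {k}. complex_of_real (B $$ (k, j)) * x $ j)"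
    by (metis norm_mult)
  also have "\<dots> \<le> (\<Sum>j\<in>{..<n} - {k}. \<bar>B $$ (k, j)\<bar> * (c * u j))"
    by (rule sum_norm_le) (auto simp: norm_mult intro!: mult_left_mono le)
  also have "\<dots> = c * (\<Sum>j\<in>{..<n} - {k}. \<bar>B $$ (k, j)\<bar> * u j)"
    by (simp add: sum_distrib_left algebra_simps)
  also have "\<dots> < c * (B $$ (k, k) * u k)" using dom[OF k(1)] c by simp
  also have "\<dots> = B $$ (k, k) * cmod (x $ k)" by (simp add: xk)
  finally have "cmod (l - complex_of_real (B $$ (k, k))) < B $$ (k, k)"
    using xk c u[OF k(1)] by simp
  moreover have "\<bar>Re (l - complex_of_real (B $$ (k, k)))\<bar>
      \<le> cmod (l - complex_of_real (B $$ (k, k)))" by (rule abs_Re_le_cmod)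
  ultimately show ?thesis by simp
qed

lemma comparison_mat_carrier [simp]:
  assumes "A \<in> carrier_mat n n"
  shows "comparison_mat A \<in> carrier_mat n n"
  using assms by (auto simp: comparison_mat_def)

lemma comparison_mat_index:
  assumes "A \<in> carrier_mat n n" "i < n" "j < n"
  shows "comparison_mat A $$ (i, j) = (if i = j then \<bar>A $$ (i, i)\<bar> else - \<bar>A $$ (i, j)\<bar>)"
  using assms by (auto simp: comparison_mat_def)

lemma comparison_mat_uminus:
  assumes "A \<in> carrier_mat n n"
  shows "comparison_mat (- A) = comparison_mat A"
  using assms by (auto simp: comparison_mat_def intro!: eq_matI)

lemma H_plus_matsI_weighted_dominance:
  assumes n: "n \<ge> 1" and C: "C \<in> carrier_mat n n"
    and u: "\<And>i. i < n \<Longrightarrow> u i > 0"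
    and diag: "\<And>i. i < n \<Longrightarrow> C $$ (i, i) > 0"
    and dom: "\<And>i. i < n \<Longrightarrow> (\<Sum>j\<in>{..<n} - {i}. \<bar>C $$ (i, j)\<bar> * u j) < C $$ (i, i) * u i"
  shows "C \<in> H_plus_mats n"
proof -
  let ?K = "comparison_mat C" and ?B = "map_mat complex_of_real (comparison_mat C)"
  have K: "?K \<in> carrier_mat n n" using C by simp
  have B: "?B \<in> carrier_mat n n" using K by simp
  have pos: "Re l > 0" if "l \<in> spectrum ?B" for l
  proof (rule weighted_dominance_imp_Re_pos[OF K u _ that])
    fix i assume i: "i < n"
    have "(\<Sum>j\<in>{..<n} - {i}. \<bar>?K $$ (i, j)\<bar> * u j)
        = (\<Sum>j\<in>{..<n} - {i}. \<bar>C $$ (i, j)\<bar> * u j)"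
      using i C by (intro sum.cong) (auto simp: comparison_mat_index)
    then show "(\<Sum>j\<in>{..<n} - {i}. \<bar>?K $$ (i, j)\<bar> * u j) < ?K $$ (i, i) * u i"
      using dom[OF i] diag[OF i] i C by (simp add: comparison_mat_index)
  qed
  have "spectrum ?B \<noteq> {}" "finite (spectrum ?B)"
    using spectrum_non_empty[OF B] card_finite_spectrum[OF B] n by auto
  then have "min_Re_eigenvalue ?K \<ge> 0"
    unfolding min_Re_eigenvalue_def using pos by (auto simp: less_imp_le)
  then show ?thesis using C diag by (simp add: H_plus_mats_def H_mats_def)
qed

lemma det_shift_nonzero:
  fixes M :: "real mat"
  assumes M: "M \<in> carrier_mat n n" and ev: "min_Re_eigenvalue M \<ge> 0"
    and inv: "invertible_mat M" and t: "t \<ge> 0"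
  shows "det (M + t \<cdot>\<^sub>m 1\<^sub>m n) \<noteq> 0"
proof
  let ?B = "map_mat complex_of_real M"
  assume "det (M + t \<cdot>\<^sub>m 1\<^sub>m n) = 0"
  then obtain x where x: "x \<in> carrier_vec n" "x \<noteq> 0\<^sub>v n" "(M + t \<cdot>\<^sub>m 1\<^sub>m n) *\<^sub>v x = 0\<^sub>v n"
    using det_0_iff_vec_prod_zero[of "M + t \<cdot>\<^sub>m 1\<^sub>m n" n] M by auto
  have row: "(\<Sum>j<n. M $$ (i, j) * x $ j) = - t * x $ i" if "i < n" for i
    using shift_mult_mat_vec_index[OF M x(1) that, of t] x(3) that by simp
  \<comment> \<open>The spectrum is complex, so the real eigenvector has to be embedded.\<close>
  define z where "z = map_vec complex_of_real x"
  have z: "z \<in> carrier_vec n" using x by (simp add: z_def)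
  have zne: "z \<noteq> 0\<^sub>v n"
  proof -
    obtain p where "p < n" "x $ p \<noteq> 0" using x by (metis carrier_vecD eq_vecI index_zero_vec)
    then have "z $ p \<noteq> 0\<^sub>v n $ p" using x by (simp add: z_def)
    then show ?thesis by auto
  qed
  have "?B *\<^sub>v z = complex_of_real (- t) \<cdot>\<^sub>v z"
  proof (rule eq_vecI)
    fix i assume "i < dim_vec (complex_of_real (- t) \<cdot>\<^sub>v z)"
    then have i: "i < n" using z by simp
    have "(?B *\<^sub>v z) $ i = (\<Sum>j<n. complex_of_real (M $$ (i, j) * x $ j))"
      using mult_mat_vec_index_sum[of ?B n n z i] M x z i by (simp add: z_def)
    also have "\<dots> = complex_of_real (\<Sum>j<n. M $$ (i, j) * x $ j)" by simp
    also have "\<dots> = complex_of_real (- t * x $ i)" using row[OF i] by metis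
    finally show "(?B *\<^sub>v z) $ i = (complex_of_real (- t) \<cdot>\<^sub>v z) $ i"
      using x i by (simp add: z_def)
  qed (use M z in auto)
  then have mem: "complex_of_real (- t) \<in> spectrum ?B"
    using z zne M by (auto simp: spectrum_def eigenvalue_def eigenvector_def)
  have "finite (spectrum ?B)" using card_finite_spectrum(1)[of ?B n] M by simp
  then have "min_Re_eigenvalue M \<le> Re (complex_of_real (- t))"
    unfolding min_Re_eigenvalue_def by (intro Min_le finite_imageI imageI mem)
  then have t0: "t = 0" using ev t by simp
  \<comment> \<open>So \<open>x\<close> is in the kernel of the invertible matrix \<open>M\<close>.\<close>
  have Mx: "M *\<^sub>v x = 0\<^sub>v n"
    using M mult_mat_vec_index_sum[OF M x(1)] row t0 by (intro eq_vecI) auto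
  obtain D where D: "M * D = 1\<^sub>m n" "D * M = 1\<^sub>m (dim_row D)"
    using inv M by (auto simp: invertible_mat_def inverts_mat_def)
  have "dim_col (M * D) = n" "dim_col (D * M) = dim_row D" using D by auto
  then have Dc: "D \<in> carrier_mat n n" using M by auto
  have "x = (D * M) *\<^sub>v x" using D Dc x by simp
  also have "\<dots> = D *\<^sub>v (M *\<^sub>v x)" using assoc_mult_mat_vec[OF Dc M x(1)] .
  also have "\<dots> = 0\<^sub>v n" using Mx Dc by (auto intro!: eq_vecI simp: scalar_prod_def)
  finally show False using x by simp
qed

section \<open>Positive pairs and diagonal scaling\<close>

lemma positive_pair_exists:
  assumes A: "A \<in> carrier_mat n n"
    and d: "\<And>t. t \<ge> 0 \<Longrightarrow> det (comparison_mat A + t \<cdot>\<^sub>m 1\<^sub>m n) \<noteq> 0"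
  shows "\<exists>v w. positive_pair n (comparison_mat A) v w"
proof -
  let ?M = "comparison_mat A"
  have M: "?M \<in> carrier_mat n n" using A by simp
  have MT: "transpose_mat ?M \<in> carrier_mat n n" using M by simp
  obtain v where v: "v \<in> carrier_vec n" "\<And>i. i < n \<Longrightarrow> v $ i > 0"
      "\<And>i. i < n \<Longrightarrow> (?M *\<^sub>v v) $ i > 0"
    by (rule z_matrix_semipositive[OF M _ d]) (use A in \<open>auto simp: comparison_mat_index\<close>)
  have dT: "det (transpose_mat ?M + t \<cdot>\<^sub>m 1\<^sub>m n) \<noteq> 0" if "t \<ge> 0" for t
  proof -
    have "transpose_mat ?M + t \<cdot>\<^sub>m 1\<^sub>m n = transpose_mat (?M + t \<cdot>\<^sub>m 1\<^sub>m n)"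
      using M by (intro eq_matI) auto
    moreover have "det (transpose_mat (?M + t \<cdot>\<^sub>m 1\<^sub>m n)) = det (?M + t \<cdot>\<^sub>m 1\<^sub>m n)"
      using M by (intro det_transpose[of _ n]) simp
    ultimately show ?thesis using d[OF that] by simp
  qed
  obtain w where w: "w \<in> carrier_vec n" "\<And>i. i < n \<Longrightarrow> w $ i > 0"
      "\<And>i. i < n \<Longrightarrow> (transpose_mat ?M *\<^sub>v w) $ i > 0"
    by (rule z_matrix_semipositive[OF MT _ dT]) (use A carrier_matD[OF M] in \<open>auto simp: comparison_mat_index\<close>)
  have "positive_pair n ?M v w"
    using v w M unfolding positive_pair_def positive_vec_def
    by (auto simp: vec_mult_mat_eq_transpose[OF M w(1)] simp del: index_mult_mat_vec)
  then show ?thesis by blast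
qed

text \<open>
  Row \<open>i\<close> of \<open>M v > 0\<close> scaled by \<open>w\<^sub>i\<close> and column \<open>i\<close> of \<open>w\<^sup>T M > 0\<close> scaled by \<open>v\<^sub>i\<close> bound the two
  halves of the left-hand side, and each has the same diagonal term \<open>\<bar>a\<^sub>i\<^sub>i\<bar> v\<^sub>i w\<^sub>i\<close>.
\<close>

lemma positive_pair_row_dominance:
  assumes A: "A \<in> carrier_mat n n"
    and vw: "positive_pair n (comparison_mat A) v w" and i: "i < n"
  shows "(\<Sum>j\<in>{..<n} - {i}. \<bar>w $ i * A $$ (i, j) * v $ j + v $ i * A $$ (j, i) * w $ j\<bar>)
    < 2 * \<bar>A $$ (i, i)\<bar> * v $ i * w $ i"
proof -
  let ?M = "comparison_mat A" and ?J = "{..<n} - {i}"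
  have M: "?M \<in> carrier_mat n n" using A by simp
  have v: "v \<in> carrier_vec n" and w: "w \<in> carrier_vec n"
    and vp: "\<And>j. j < n \<Longrightarrow> v $ j > 0" and wp: "\<And>j. j < n \<Longrightarrow> w $ j > 0"
    using vw by (auto simp: positive_pair_def positive_vec_def)
  have "(?M *\<^sub>v v) $ i > 0" "vec_mult_mat w ?M $ i > 0"
    using vw i M carrier_vecD[OF vec_mult_mat_carrier[OF M, of w]]
    by (auto simp: positive_pair_def positive_vec_def)
  then have "(\<Sum>j<n. ?M $$ (i, j) * v $ j) > 0" "(\<Sum>j<n. w $ j * ?M $$ (j, i)) > 0"
    using mult_mat_vec_index_sum[OF M v i] vec_mult_mat_index_sum[OF M w i] by auto
  moreover have "(\<Sum>j<n. ?M $$ (i, j) * v $ j)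
      = \<bar>A $$ (i, i)\<bar> * v $ i - (\<Sum>j\<in>?J. \<bar>A $$ (i, j)\<bar> * v $ j)"
    using i A by (subst sum.remove[of _ i])
      (auto simp: comparison_mat_index sum_negf[symmetric] intro!: sum.cong)
  moreover have "(\<Sum>j<n. w $ j * ?M $$ (j, i))
      = \<bar>A $$ (i, i)\<bar> * w $ i - (\<Sum>j\<in>?J. \<bar>A $$ (j, i)\<bar> * w $ j)"
    using i A by (subst sum.remove[of _ i])
      (auto simp: comparison_mat_index sum_negf[symmetric] intro!: sum.cong)
  ultimately have row: "(\<Sum>j\<in>?J. \<bar>A $$ (i, j)\<bar> * v $ j) < \<bar>A $$ (i, i)\<bar> * v $ i"
    and col: "(\<Sum>j\<in>?J. \<bar>A $$ (j, i)\<bar> * w $ j) < \<bar>A $$ (i, i)\<bar> * w $ i"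
    by auto
  have "(\<Sum>j\<in>?J. \<bar>w $ i * A $$ (i, j) * v $ j + v $ i * A $$ (j, i) * w $ j\<bar>)
      \<le> (\<Sum>j\<in>?J. w $ i * (\<bar>A $$ (i, j)\<bar> * v $ j) + v $ i * (\<bar>A $$ (j, i)\<bar> * w $ j))"
  proof (rule sum_mono)
    fix j assume "j \<in> ?J"
    then have "\<bar>v $ j\<bar> = v $ j" "\<bar>w $ j\<bar> = w $ j" "\<bar>v $ i\<bar> = v $ i" "\<bar>w $ i\<bar> = w $ i"
      using vp wp i by (auto simp: less_imp_le)
    then show "\<bar>w $ i * A $$ (i, j) * v $ j + v $ i * A $$ (j, i) * w $ j\<bar>
        \<le> w $ i * (\<bar>A $$ (i, j)\<bar> * v $ j) + v $ i * (\<bar>A $$ (j, i)\<bar> * w $ j)"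
      using abs_triangle_ineq[of "w $ i * A $$ (i, j) * v $ j" "v $ i * A $$ (j, i) * w $ j"]
      by (simp add: abs_mult mult.assoc)
  qed
  also have "\<dots> = w $ i * (\<Sum>j\<in>?J. \<bar>A $$ (i, j)\<bar> * v $ j)
      + v $ i * (\<Sum>j\<in>?J. \<bar>A $$ (j, i)\<bar> * w $ j)"
    by (simp add: sum.distrib sum_distrib_left)
  also have "\<dots> < w $ i * (\<bar>A $$ (i, i)\<bar> * v $ i) + v $ i * (\<bar>A $$ (i, i)\<bar> * w $ i)"
    using row col vp[OF i] wp[OF i] by (intro add_strict_mono mult_strict_left_mono)
  also have "\<dots> = 2 * \<bar>A $$ (i, i)\<bar> * v $ i * w $ i" by simp
  finally show ?thesis .
qed

lemma diag_of_vec_quotient: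
  assumes "positive_pair n M v w"
  shows "diag_of_vec v * inv_mat (diag_of_vec w) = mat_diag n (\<lambda>i. v $ i / w $ i)"
proof -
  have v: "v \<in> carrier_vec n" and w: "w \<in> carrier_vec n" and wp: "\<forall>i<n. w $ i > 0"
    using assms by (auto simp: positive_pair_def positive_vec_def)
  have "inv_mat (diag_of_vec w) = mat_diag n (\<lambda>i. 1 / w $ i)"
    by (rule inv_mat_diag_of_vec[OF w]) (use wp in force)
  then show ?thesis using v by (simp add: diag_of_vec_def)
qed

lemma positive_pair_lyapunov_H_plus:
  assumes n: "n \<ge> 1" and A: "A \<in> carrier_mat n n"
    and neg: "\<And>i. i < n \<Longrightarrow> A $$ (i, i) < 0"
    and vw: "positive_pair n (comparison_mat A) v w"
    and X: "X = mat_diag n (\<lambda>i. v $ i / w $ i)"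
  shows "- (A * X + X * transpose_mat A) \<in> H_plus_mats n"
proof (rule H_plus_matsI_weighted_dominance[where u = "\<lambda>i. w $ i"])
  have vp: "\<And>j. j < n \<Longrightarrow> v $ j > 0" and wp: "\<And>j. j < n \<Longrightarrow> w $ j > 0"
    using vw by (auto simp: positive_pair_def positive_vec_def)
  let ?C = "- (A * X + X * transpose_mat A)"
  have AT: "transpose_mat A \<in> carrier_mat n n" using A by simp
  show "?C \<in> carrier_mat n n" using A by (auto simp: X mat_diag_def)
  have C: "?C $$ (i, j) = - (A $$ (i, j) * (v $ j / w $ j) + (v $ i / w $ i) * A $$ (j, i))"
    if "i < n" "j < n" for i j
    using that A by (simp add: X mat_diag_mult_right[OF A] mat_diag_mult_left[OF AT])
  fix i assume i: "i < n"
  show "w $ i > 0" using wp i .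
  have diag: "?C $$ (i, i) = 2 * \<bar>A $$ (i, i)\<bar> * (v $ i / w $ i)"
    using neg[OF i] by (simp add: C[OF i i])
  show "?C $$ (i, i) > 0"
    unfolding diag using neg[OF i] vp[OF i] wp[OF i] by (intro mult_pos_pos divide_pos_pos) auto
  have "w $ i * (\<Sum>j\<in>{..<n} - {i}. \<bar>?C $$ (i, j)\<bar> * w $ j)
      = (\<Sum>j\<in>{..<n} - {i}. \<bar>w $ i * A $$ (i, j) * v $ j + v $ i * A $$ (j, i) * w $ j\<bar>)"
    unfolding sum_distrib_left
  proof (rule sum.cong[OF refl])
    fix j assume "j \<in> {..<n} - {i}"
    then have j: "j < n" by simp
    have "w $ i * (\<bar>?C $$ (i, j)\<bar> * w $ j) = \<bar>w $ i * ?C $$ (i, j) * w $ j\<bar>"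
      using wp[OF i] wp[OF j] by (simp add: abs_mult)
    also have "w $ i * ?C $$ (i, j) * w $ j
        = - (w $ i * A $$ (i, j) * v $ j + v $ i * A $$ (j, i) * w $ j)"
      using wp[OF i] wp[OF j] by (simp add: C[OF i j] field_simps)
    finally show "w $ i * (\<bar>?C $$ (i, j)\<bar> * w $ j)
        = \<bar>w $ i * A $$ (i, j) * v $ j + v $ i * A $$ (j, i) * w $ j\<bar>" by simp
  qed
  also have "\<dots> < 2 * \<bar>A $$ (i, i)\<bar> * v $ i * w $ i"
    using positive_pair_row_dominance[OF A vw i] .
  also have "\<dots> = w $ i * (?C $$ (i, i) * w $ i)"
    using wp[OF i] by (simp add: diag)
  finally show "(\<Sum>j\<in>{..<n} - {i}. \<bar>?C $$ (i, j)\<bar> * w $ j) < ?C $$ (i, i) * w $ i"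
    using wp[OF i] by (simp only: mult_less_cancel_left_pos)
qed (use n in simp)

lemma positive_pair_scaling_DD_plus:
  assumes A: "A \<in> carrier_mat n n"
    and neg: "\<And>i. i < n \<Longrightarrow> A $$ (i, i) < 0"
    and vw: "positive_pair n (comparison_mat A) v w"
    and P: "P = diag_of_vec w"
    and Y: "Y = mat_diag n (\<lambda>i. v $ i * w $ i)"
  shows "- (P * A * inv_mat P * Y) - Y * inv_mat P * transpose_mat A * P \<in> DD_plus n"
proof -
  have v: "v \<in> carrier_vec n" and w: "w \<in> carrier_vec n"
    and vp: "\<And>j. j < n \<Longrightarrow> v $ j > 0" and wp: "\<And>j. j < n \<Longrightarrow> w $ j > 0"
    using vw by (auto simp: positive_pair_def positive_vec_def)
  define Q where "Q = mat_diag n (\<lambda>i. 1 / w $ i)"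
  have Q: "inv_mat P = Q"
    unfolding P Q_def by (rule inv_mat_diag_of_vec[OF w]) (use wp in force)
  have PD: "P = mat_diag n (\<lambda>i. w $ i)" using w by (simp add: P diag_of_vec_def)
  let ?N = "- (P * A * Q * Y) - Y * Q * transpose_mat A * P"
  let ?f = "\<lambda>i j. w $ i * A $$ (i, j) * v $ j + v $ i * A $$ (j, i) * w $ j"
  have c: "P \<in> carrier_mat n n" "Q \<in> carrier_mat n n" "Y \<in> carrier_mat n n"
    "transpose_mat A \<in> carrier_mat n n"
    using A by (simp_all add: PD Q_def Y)
  have N: "?N \<in> carrier_mat n n" using A c by auto
  have ent: "?N $$ (i, j) = - ?f i j" if ij: "i < n" "j < n" for i j
  proof -
    have PA: "P * A = mat n n (\<lambda>(i, j). w $ i * A $$ (i, j))"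
      unfolding PD by (rule mat_diag_mult_left[OF A])
    have "P * A * Q = mat n n (\<lambda>(i, j). w $ i * A $$ (i, j) * (1 / w $ j))"
      unfolding PA Q_def by (subst mat_diag_mult_right[of _ n]) (auto intro!: eq_matI)
    then have 1: "P * A * Q * Y
        = mat n n (\<lambda>(i, j). w $ i * A $$ (i, j) * (1 / w $ j) * (v $ j * w $ j))"
      unfolding Y by (simp only:, subst mat_diag_mult_right[of _ n]) (auto intro!: eq_matI)
    have "Y * Q * transpose_mat A
        = mat n n (\<lambda>(i, j). v $ i * w $ i * (1 / w $ i) * A $$ (j, i))"
      unfolding Y Q_def mat_diag_diag using A c
      by (subst mat_diag_mult_left[of _ n n]) (auto intro!: eq_matI)
    then have 2: "Y * Q * transpose_mat A * P
        = mat n n (\<lambda>(i, j). v $ i * w $ i * (1 / w $ i) * A $$ (j, i) * w $ j)"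
      unfolding PD by (simp only:, subst mat_diag_mult_right[of _ n]) (auto intro!: eq_matI)
    show ?thesis using ij wp[OF ij(1)] wp[OF ij(2)] by (simp add: 1 2)
  qed
  have diag: "?N $$ (i, i) = 2 * \<bar>A $$ (i, i)\<bar> * v $ i * w $ i" if "i < n" for i
    using neg[OF that] by (simp only: ent[OF that that]) (simp add: algebra_simps)
  have sym: "transpose_mat ?N = ?N"
  proof (rule eq_matI)
    fix i j assume "i < dim_row ?N" "j < dim_col ?N"
    then have ij: "i < n" "j < n" using N by blast+
    have "transpose_mat ?N $$ (i, j) = ?N $$ (j, i)" using N ij by (intro index_transpose_mat) auto
    then show "transpose_mat ?N $$ (i, j) = ?N $$ (i, j)" using ij by (simp only: ent) simp
  qed (use N in \<open>simp_all only: index_transpose_mat carrier_matD\<close>)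
  have pos: "?N $$ (i, i) > 0" if i: "i < n" for i
    unfolding diag[OF i] using neg[OF i] vp[OF i] wp[OF i] by (intro mult_pos_pos) auto
  have "strictly_row_diag_dominant ?N"
    unfolding strictly_row_diag_dominant_def
  proof (intro allI impI)
    fix i assume "i < dim_row ?N"
    then have i: "i < n" using N by blast
    have "(\<Sum>j\<in>{..<dim_col ?N} - {i}. \<bar>?N $$ (i, j)\<bar>) = (\<Sum>j\<in>{..<n} - {i}. \<bar>?f i j\<bar>)"
    proof (rule sum.cong)
      show "{..<dim_col ?N} - {i} = {..<n} - {i}" using N by blast
      fix j assume "j \<in> {..<n} - {i}"
      then have j: "j < n" by simp
      show "\<bar>?N $$ (i, j)\<bar> = \<bar>?f i j\<bar>" unfolding ent[OF i j] by (rule abs_minus_cancel)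
    qed
    also have "\<dots> < ?N $$ (i, i)"
      unfolding diag[OF i] by (rule positive_pair_row_dominance[OF A vw i])
    also have "\<dots> \<le> \<bar>?N $$ (i, i)\<bar>" by (rule abs_ge_self)
    finally show "(\<Sum>j\<in>{..<dim_col ?N} - {i}. \<bar>?N $$ (i, j)\<bar>) < \<bar>?N $$ (i, i)\<bar>" .
  qed
  then have "?N \<in> DD_plus n" unfolding DD_plus_def using N sym pos by simp
  then show ?thesis unfolding Q .
qed

theorem theorem1:
  fixes A :: "real mat" and n :: nat
  assumes "n \<ge> 1"
    and "A \<in> carrier_mat n n"
    and "- A \<in> H_plus_mats n"
    and "invertible_mat (comparison_mat A)"
  shows
    "(\<exists>v w. positive_pair n (comparison_mat A) v w) \<and>
     ((\<exists>X \<in> carrier_mat n n. diagonal_mat X \<and>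
         - (A * X + X * transpose_mat A) \<in> H_plus_mats n) \<and>
      (\<forall>v w. positive_pair n (comparison_mat A) v w \<longrightarrow>
         (let X = diag_of_vec v * inv_mat (diag_of_vec w) in
            X \<in> carrier_mat n n \<and> diagonal_mat X \<and>
            - (A * X + X * transpose_mat A) \<in> H_plus_mats n))) \<and>
     (\<forall>v w. positive_pair n (comparison_mat A) v w \<longrightarrow>
        (let P = diag_of_vec w in
           \<exists>Y \<in> carrier_mat n n. diagonal_mat Y \<and> positive_definite Y \<and>
             - (P * A * inv_mat P * Y) - Y * inv_mat P * transpose_mat A * P \<in> DD_plus n))"
proof -
  let ?M = "comparison_mat A"
  have A: "A \<in> carrier_mat n n" and n: "n \<ge> 1" by fact+
  have M: "?M \<in> carrier_mat n n" using A by simp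
  have neg: "A $$ (i, i) < 0" if "i < n" for i
    using assms(3) A that by (auto simp: H_plus_mats_def)
  have "min_Re_eigenvalue ?M \<ge> 0"
    using assms(3) by (simp add: H_plus_mats_def H_mats_def comparison_mat_uminus[OF A])
  then have d: "det (?M + t \<cdot>\<^sub>m 1\<^sub>m n) \<noteq> 0" if "t \<ge> 0" for t
    using det_shift_nonzero[OF M _ assms(4) that] by blast
  have ex: "\<exists>v w. positive_pair n ?M v w" by (rule positive_pair_exists[OF A d])
  have X: "\<forall>v w. positive_pair n ?M v w \<longrightarrow>
      (let X = diag_of_vec v * inv_mat (diag_of_vec w) in
         X \<in> carrier_mat n n \<and> diagonal_mat X \<and>
         - (A * X + X * transpose_mat A) \<in> H_plus_mats n)"
    using positive_pair_lyapunov_H_plus[OF n A neg _ refl]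
    by (auto simp: Let_def diag_of_vec_quotient)
  have X_ex: "\<exists>X \<in> carrier_mat n n. diagonal_mat X \<and>
      - (A * X + X * transpose_mat A) \<in> H_plus_mats n"
    using ex X by (meson Let_def)
  have Y: "let P = diag_of_vec w in
      \<exists>Y \<in> carrier_mat n n. diagonal_mat Y \<and> positive_definite Y \<and>
        - (P * A * inv_mat P * Y) - Y * inv_mat P * transpose_mat A * P \<in> DD_plus n"
    if vw: "positive_pair n ?M v w" for v w
  proof -
    let ?Y = "mat_diag n (\<lambda>i. v $ i * w $ i)"
    have "positive_definite ?Y"
      using vw by (intro positive_definite_mat_diag) (auto simp: positive_pair_def positive_vec_def)
    then show ?thesis
      unfolding Let_def using positive_pair_scaling_DD_plus[OF A neg vw refl refl]
      by (intro bexI[of _ ?Y]) auto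
  qed
  show ?thesis using ex X_ex X Y by blast
qed

end
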